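(* Let $N\ge 1$ be an integer and let $s\in\mathbb{C}$ with $\Re(s)>-2N$. Then $$ \eta_N(s)=\frac12\,\det\begin{pmatrix} 1 & \frac{1}{3!} & \cdots & \frac{1}{(2N-1)!}\\ 2^{1-s} & \frac{2^3}{3!} & \cdots & \frac{2^{2N-1}}{(2N-1)!}\\ \vdots & \vdots & & \vdots\\ N^{1-s} & \frac{N^3}{3!} & \cdots & \frac{N^{2N-1}}{(2N-1)!} \end{pmatrix}, $$ where the matrix is the $N\times N$ matrix whose $(i,1)$ entry is $i^{1-s}$ and whose $(i,j)$ entry for $2\le j\le N$ is $\frac{i^{2j-1}}{(2j-1)!}$.
   Context: For $1\le n\le N$ put $$a_{n,N}=\frac12\prod_{\substack{1\le j\le N\\ j\ne n}}\frac{j^2}{j^2-n^2}=(-1)^{n-1}\frac{\binom{2N}{N-n}}{\binom{2N}{N}},$$ and define $\eta_N(s)=\sum_{n=1}^N \frac{a_{n,N}}{n^s}$, where $n^{-s}=e^{-s\log n}$ with the real logarithm. *)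

theory Defs
  imports "HOL-Analysis.Complex_Transcendental" "Jordan_Normal_Form.Determinant"
begin

definition a_coeff :: "nat \<Rightarrow> nat \<Rightarrow> real" where
  "a_coeff n N = 1 / 2 * (\<Prod>j\<in>{1..N} - {n}. (real j)\<^sup>2 / ((real j)\<^sup>2 - (real n)\<^sup>2))"

definition eta :: "nat \<Rightarrow> complex \<Rightarrow> complex" where
  "eta N s = (\<Sum>n = 1..N. complex_of_real (a_coeff n N) / of_nat n powr s)"

text \<open>On positive integers the complex \<open>powr\<close> is the power taken with the real logarithm.\<close>

lemma of_nat_powr_real_ln:
  assumes "n \<ge> 1"
  shows "(of_nat n :: complex) powr s = exp (s * complex_of_real (ln (real n)))"
  using assms Ln_of_real[of "real n"] by (simp add: powr_def)

text \<open>Entries with 1-based row and column indices \<open>i, j \<ge> 1\<close>; matrices of type \<open>mat\<close> are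
  indexed from 0.\<close>

definition eta_entry :: "complex \<Rightarrow> nat \<Rightarrow> nat \<Rightarrow> complex" where
  "eta_entry s i j =
     (if j = 1 then of_nat i powr (1 - s) else of_nat i ^ (2 * j - 1) / fact (2 * j - 1))"

definition eta_matrix :: "nat \<Rightarrow> complex \<Rightarrow> complex mat" where
  "eta_matrix N s = mat N N (\<lambda>(i, j). eta_entry s (i + 1) (j + 1))"

end

theory Submission
  imports Defs
begin

text \<open>
  If a row vector \<open>v\<close> satisfies \<open>v A = c e\<^sub>k\<close>, multiplication by the adjugate shows that
  \<open>det A \<cdot> v\<close> is \<open>c\<close> times the vector of cofactors along column \<open>k\<close>. Lagrange interpolation at
  the nodes \<open>1\<^sup>2, \<dots>, N\<^sup>2\<close> supplies two such vectors for the matrix of odd powers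
  \<open>i\<^bsup>2j-1\<^esup>/(2j-1)!\<close>, which is the case \<open>s = 0\<close>. Reading off leading coefficients gives \<open>k = N\<close>
  and, by induction on \<open>N\<close>, the determinant \<open>1\<close>; evaluating at \<open>0\<close> gives \<open>k = 1\<close> and identifies
  the cofactors along the first column as \<open>2 a\<^bsub>n,N\<^esub>/n\<close>. These cofactors do not involve the first
  column, so expanding along it gives the claim for every \<open>s\<close>.
\<close>

text \<open>Both sides have degree below \<open>card A\<close> and agree at the
  \<open>card A\<close> distinct nodes \<open>f x\<close>. Nodes are an indexed family so that they
  can later be the squares of the row numbers.\<close>

lemma lagrange_interpolation:
  fixes p :: "'a :: field poly"
  assumes "finite A" "inj_on f A" "degree p < card A"
  shows "p = (\<Sum>x\<in>A. smult (poly p (f x) / (\<Prod>y\<in>A - {x}. f x - f y)) (\<Prod>y\<in>A - {x}. [:- f y, 1:]))"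
    (is "p = ?q")
proof (rule poly_eqI_degree)
  have card: "card (f ` A) = card A"
    using assms(2) by (rule card_image)
  then show "degree p < card (f ` A)"
    using assms(3) by simp
  have "degree (\<Prod>y\<in>A - {x}. [:- f y, 1:]) \<le> card A - 1" if "x \<in> A" for x
    using that assms(1) by (subst degree_prod_sum_eq) auto
  then have "degree ?q \<le> card A - 1"
    by (intro degree_sum_le[OF assms(1)] order.trans[OF degree_smult_le])
  then show "degree ?q < card (f ` A)"
    using card assms(3) by simp
next
  fix z assume "z \<in> f ` A"
  then obtain a where a: "a \<in> A" "z = f a" by auto
  have nz: "(\<Prod>y\<in>A - {a}. f a - f y) \<noteq> 0"
    using assms(1,2) a(1) by (auto simp: inj_on_def)
  have "poly ?q z = (\<Sum>x\<in>A. if x = a then poly p (f a) else 0)"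
    unfolding poly_sum
  proof (rule sum.cong)
    fix x assume "x \<in> A"
    show "poly (smult (poly p (f x) / (\<Prod>y\<in>A - {x}. f x - f y)) (\<Prod>y\<in>A - {x}. [:- f y, 1:])) z
        = (if x = a then poly p (f a) else 0)"
    proof (cases "x = a")
      case True
      then show ?thesis using nz a(2) by (simp add: poly_prod)
    next
      case False
      then have "(\<Prod>y\<in>A - {x}. f a - f y) = 0"
        using assms(1) a(1) by (auto intro!: prod_zero)
      then show ?thesis using False a(2) by (simp add: poly_prod)
    qed
  qed simp
  then show "poly p z = poly ?q z"
    using assms(1) a by simp
qed

text \<open>Compare the coefficients of X^(card A - 1) in the interpolation of X^k: each basis
  product is monic of exactly that degree.\<close>

lemma sum_power_div_node_differences:
  fixes f :: "'b \<Rightarrow> 'a :: field"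
  assumes "finite A" "inj_on f A" "k < card A"
  shows "(\<Sum>x\<in>A. f x ^ k / (\<Prod>y\<in>A - {x}. f x - f y)) = (if k = card A - 1 then 1 else 0)"
proof -
  have "coeff (\<Prod>y\<in>A - {x}. [:- f y, 1:]) (card A - 1) = 1" if "x \<in> A" for x
    using that assms(1) lead_coeff_prod[of "\<lambda>y. [:- f y, 1:]" "A - {x}"]
      degree_prod_sum_eq[of "A - {x}" "\<lambda>y. [:- f y, 1:]"] by simp
  moreover have "monom 1 k = (\<Sum>x\<in>A. smult (poly (monom 1 k) (f x) / (\<Prod>y\<in>A - {x}. f x - f y))
      (\<Prod>y\<in>A - {x}. [:- f y, 1:]))"
    using assms by (intro lagrange_interpolation) (auto simp: degree_monom_eq)
  from arg_cong[OF this, of "\<lambda>p. coeff p (card A - 1)"]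
  have "(if k = card A - 1 then 1 else 0) = (\<Sum>x\<in>A. f x ^ k / (\<Prod>y\<in>A - {x}. f x - f y)
      * coeff (\<Prod>y\<in>A - {x}. [:- f y, 1:]) (card A - 1))"
    by (simp add: coeff_sum poly_monom)
  ultimately show ?thesis by simp
qed

text \<open>Evaluate the interpolation of X^k at 0.\<close>

lemma sum_power_times_lagrange_at_zero:
  fixes f :: "'b \<Rightarrow> 'a :: field"
  assumes "finite A" "inj_on f A" "k < card A"
  shows "(\<Sum>x\<in>A. f x ^ k * (\<Prod>y\<in>A - {x}. f y / (f y - f x))) = (if k = 0 then 1 else 0)"
proof -
  have flip: "- f y / (f x - f y) = f y / (f y - f x)" for x y
    by (metis minus_diff_eq minus_divide_divide)
  have "monom 1 k = (\<Sum>x\<in>A. smult (poly (monom 1 k) (f x) / (\<Prod>y\<in>A - {x}. f x - f y))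
      (\<Prod>y\<in>A - {x}. [:- f y, 1:]))"
    using assms by (intro lagrange_interpolation) (auto simp: degree_monom_eq)
  from arg_cong[OF this, of "\<lambda>p. poly p 0"]
  have "(if k = 0 then 1 else 0) = (\<Sum>x\<in>A. f x ^ k *
      ((\<Prod>y\<in>A - {x}. - f y) / (\<Prod>y\<in>A - {x}. f x - f y)))"
    by (simp add: poly_sum poly_monom poly_prod power_0_left)
  also have "\<dots> = (\<Sum>x\<in>A. f x ^ k * (\<Prod>y\<in>A - {x}. f y / (f y - f x)))"
    by (simp only: prod_dividef[symmetric] flip)
  finally show ?thesis by simp
qed

text \<open>Entry \<open>l\<close> of v A adj(A), bracketed in two ways. Nothing is divided by
  \<open>det A\<close>, so this applies before the determinant is known to be nonzero.\<close>

lemma mult_det_eq_mult_cofactor: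
  fixes A :: "'a :: comm_ring_1 mat"
  assumes A: "A \<in> carrier_mat n n" and k: "k < n" and l: "l < n"
    and v: "\<And>j. j < n \<Longrightarrow> (\<Sum>i<n. v i * A $$ (i, j)) = (if j = k then c else 0)"
  shows "v l * det A = c * cofactor A l k"
proof -
  have row: "(\<Sum>j<n. A $$ (i, j) * cofactor A l j) = (if i = l then det A else 0)"
    if "i < n" for i
  proof -
    have "(\<Sum>j<n. A $$ (i, j) * cofactor A l j) = (A * adj_mat A) $$ (i, l)"
      using that l A
      by (auto simp: times_mat_def scalar_prod_def adj_mat_def atLeast0LessThan intro!: sum.cong)
    then show ?thesis using adj_mat(2)[OF A] that l by simp
  qed
  have "v l * det A = (\<Sum>i<n. v i * (if i = l then det A else 0))"
    using l by (simp add: if_distrib cong: if_cong)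
  also have "\<dots> = (\<Sum>i<n. v i * (\<Sum>j<n. A $$ (i, j) * cofactor A l j))"
    using row by simp
  also have "\<dots> = (\<Sum>i<n. \<Sum>j<n. v i * A $$ (i, j) * cofactor A l j)"
    by (simp add: sum_distrib_left mult.assoc)
  also have "\<dots> = (\<Sum>j<n. \<Sum>i<n. v i * A $$ (i, j) * cofactor A l j)"
    by (rule sum.swap)
  also have "\<dots> = (\<Sum>j<n. (if j = k then c else 0) * cofactor A l j)"
    using v by (simp add: sum_distrib_right[symmetric])
  also have "\<dots> = (\<Sum>j<n. if j = k then c * cofactor A l k else 0)"
    by (rule sum.cong) auto
  also have "\<dots> = c * cofactor A l k"
    using k by simp
  finally show ?thesis .
qed

lemma eta_matrix_carrier: "eta_matrix N s \<in> carrier_mat N N"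
  by (simp add: eta_matrix_def)

text \<open>At s = 0 the exceptional first column is i^1/1! and fits the pattern of the others.
  Beyond one factor i, every entry is a power of the node i^2, up to a factorial.\<close>

lemma eta_matrix_0_index:
  assumes "i < N" "j < N"
  shows "eta_matrix N 0 $$ (i, j) = of_nat (Suc i) * ((of_nat (Suc i))\<^sup>2) ^ j / fact (2 * j + 1)"
  using assms by (simp add: eta_matrix_def eta_entry_def power_mult[symmetric])

lemma inj_of_nat_Suc_square: "inj_on (\<lambda>i. (of_nat (Suc i) :: complex)\<^sup>2) A"
proof (rule inj_onI)
  fix i j assume "(of_nat (Suc i) :: complex)\<^sup>2 = (of_nat (Suc j))\<^sup>2"
  then have "(Suc i)\<^sup>2 = (Suc j)\<^sup>2"
    by (metis of_nat_eq_iff of_nat_power)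
  then show "i = j" by simp
qed

lemma fact_times_prod_shift:
  "fact m * (\<Prod>j<k. of_nat (m + Suc j)) = (fact (m + k) :: 'a :: {comm_semiring_1, semiring_char_0})"
proof (induction k)
  case (Suc k)
  have "fact m * (\<Prod>j<Suc k. of_nat (m + Suc j)) = (fact m * (\<Prod>j<k. of_nat (m + Suc j))) * (of_nat (m + Suc k) :: 'a)"
    by (simp only: prod.lessThan_Suc mult.assoc)
  also have "\<dots> = fact (m + Suc k)"
    unfolding Suc.IH by (simp add: algebra_simps)
  finally show ?case .
qed simp

text \<open>After factoring the squares, the differences run through 1..n and the sums through
  n+2..2n+1; the factor n+1 fills the gap in (2n+1)!.\<close>

lemma prod_square_differences:
  "of_nat (Suc n) * (\<Prod>j<n. (of_nat (Suc n))\<^sup>2 - (of_nat (Suc j))\<^sup>2) = (fact (2 * n + 1) :: complex)"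
proof -
  have "(\<Prod>j<n. (of_nat (Suc n))\<^sup>2 - (of_nat (Suc j) :: complex)\<^sup>2)
      = (\<Prod>j<n. of_nat (Suc (n - Suc j)) * of_nat (Suc n + Suc j))"
  proof (rule prod.cong)
    fix j assume "j \<in> {..<n}"
    \<comment> \<open>Since j < n, the truncated subtraction is genuine; this form of n - j suits
      the reindexing below.\<close>
    then have diff: "(of_nat (Suc (n - Suc j)) :: complex) = of_nat (Suc n) - of_nat (Suc j)"
      by simp
    show "(of_nat (Suc n))\<^sup>2 - (of_nat (Suc j) :: complex)\<^sup>2
        = of_nat (Suc (n - Suc j)) * of_nat (Suc n + Suc j)"
      unfolding diff of_nat_add by (simp add: power2_eq_square algebra_simps)
  qed simp
  also have "\<dots> = (\<Prod>j<n. of_nat (Suc j)) * (\<Prod>j<n. of_nat (Suc n + Suc j))"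
    by (simp only: prod.distrib prod.nat_diff_reindex[where g = "\<lambda>j. of_nat (Suc j)"])
  also have "(\<Prod>j<n. of_nat (Suc j)) = (fact n :: complex)"
    using fact_times_prod_shift[of 0 n, where 'a = complex] by simp
  finally have "of_nat (Suc n) * (\<Prod>j<n. (of_nat (Suc n))\<^sup>2 - (of_nat (Suc j) :: complex)\<^sup>2)
      = fact (Suc n) * (\<Prod>j<n. of_nat (Suc n + Suc j))"
    by (simp only: fact_Suc mult.assoc)
  also have "\<dots> = fact (Suc n + n)"
    by (rule fact_times_prod_shift)
  also have "Suc n + n = 2 * n + 1"
    by simp
  finally show ?thesis .
qed

lemma det_eta_matrix_0: "det (eta_matrix N 0) = 1"
proof (induction N)
  case 0
  show ?case by (simp add: eta_matrix_def)
next
  case (Suc N)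
  define d where "d i = (\<Prod>j\<in>{..<Suc N} - {i}. (of_nat (Suc i))\<^sup>2 - (of_nat (Suc j) :: complex)\<^sup>2)" for i
  \<comment> \<open>The weight 1/(i+1) turns the odd powers into powers of the nodes; with indices
    from 0, column N is the last.\<close>
  have "(\<Sum>i<Suc N. 1 / (of_nat (Suc i) * d i) * eta_matrix (Suc N) 0 $$ (i, j))
      = (if j = N then 1 / fact (2 * N + 1) else 0)" if j: "j < Suc N" for j
  proof -
    have "(\<Sum>i<Suc N. 1 / (of_nat (Suc i) * d i) * eta_matrix (Suc N) 0 $$ (i, j))
        = (\<Sum>i<Suc N. ((of_nat (Suc i))\<^sup>2) ^ j / d i) / fact (2 * j + 1)"
      unfolding sum_divide_distrib using j
      by (intro sum.cong) (auto simp: eta_matrix_0_index simp del: of_nat_Suc)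
    then show ?thesis
      unfolding d_def using j sum_power_div_node_differences[OF _ inj_of_nat_Suc_square, of "{..<Suc N}" j]
      by simp
  qed
  \<comment> \<open>In the last row the weight is also 1/(2N+1)!, so it cancels and the determinant
    equals its lower right minor, which is the matrix of size N.\<close>
  then have "1 / (of_nat (Suc N) * d N) * det (eta_matrix (Suc N) 0)
      = 1 / fact (2 * N + 1) * cofactor (eta_matrix (Suc N) 0) N N"
    by (intro mult_det_eq_mult_cofactor[OF eta_matrix_carrier]) auto
  moreover have "{..<Suc N} - {N} = {..<N}" by auto
  then have "of_nat (Suc N) * d N = fact (2 * N + 1)"
    unfolding d_def using prod_square_differences[of N] by simp
  moreover have "mat_delete (eta_matrix (Suc N) 0) N N = eta_matrix N 0"
    by (rule eq_matI) (auto simp: mat_delete_def eta_matrix_def)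
  then have "cofactor (eta_matrix (Suc N) 0) N N = 1"
    using Suc.IH by (simp add: cofactor_def)
  ultimately show ?case by (simp del: fact_Suc)
qed

lemma cofactor_eta_matrix_0:
  assumes "l < N"
  shows "cofactor (eta_matrix N 0) l 0 = 2 * complex_of_real (a_coeff (Suc l) N) / of_nat (Suc l)"
proof -
  let ?w = "\<lambda>i. 2 * complex_of_real (a_coeff (Suc i) N) / of_nat (Suc i)"
  \<comment> \<open>Twice the coefficient is the Lagrange basis polynomial of the node (i+1)^2,
    evaluated at 0.\<close>
  have a: "2 * complex_of_real (a_coeff (Suc i) N)
      = (\<Prod>j\<in>{..<N} - {i}. (of_nat (Suc j))\<^sup>2 / ((of_nat (Suc j))\<^sup>2 - (of_nat (Suc i))\<^sup>2))" for i
  proof -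
    have "{1..N} - {Suc i} = Suc ` ({..<N} - {i})"
      by (auto simp: image_Suc_lessThan inj_image_mem_iff image_set_diff)
    then show ?thesis
      by (simp add: a_coeff_def prod.reindex del: of_nat_Suc)
  qed
  have "(\<Sum>i<N. ?w i * eta_matrix N 0 $$ (i, j)) = (if j = 0 then 1 else 0)" if j: "j < N" for j
  proof -
    have "(\<Sum>i<N. ?w i * eta_matrix N 0 $$ (i, j))
        = (\<Sum>i<N. ((of_nat (Suc i))\<^sup>2) ^ j * (2 * complex_of_real (a_coeff (Suc i) N))) / fact (2 * j + 1)"
      unfolding sum_divide_distrib using j
      by (intro sum.cong) (auto simp: eta_matrix_0_index simp del: of_nat_Suc)
    then show ?thesis
      unfolding a using j sum_power_times_lagrange_at_zero[OF _ inj_of_nat_Suc_square, of "{..<N}" j]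
      by simp
  qed
  then have "?w l * det (eta_matrix N 0) = 1 * cofactor (eta_matrix N 0) l 0"
    using assms by (intro mult_det_eq_mult_cofactor[OF eta_matrix_carrier]) auto
  then show ?thesis by (simp add: det_eta_matrix_0)
qed

theorem proposition2:
  fixes N :: nat and s :: complex
  assumes "N \<ge> 1" and "Re s > - 2 * real N"
  shows "eta N s = 1 / 2 * det (eta_matrix N s)"
proof -
  have "cofactor (eta_matrix N s) i 0 = cofactor (eta_matrix N 0) i 0" if "i < N" for i
    unfolding cofactor_def using that
    by (intro arg_cong[where f = "\<lambda>B. _ * det B"] eq_matI)
      (auto simp: mat_delete_def eta_matrix_def eta_entry_def)
  then have cof: "cofactor (eta_matrix N s) i 0 = 2 * complex_of_real (a_coeff (Suc i) N) / of_nat (Suc i)"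
    if "i < N" for i
    using that by (simp add: cofactor_eta_matrix_0)
  have entry: "eta_matrix N s $$ (i, 0) = of_nat (Suc i) powr (1 - s)" if "i < N" for i
    using that by (simp add: eta_matrix_def eta_entry_def)
  have "det (eta_matrix N s) = (\<Sum>i<N. eta_matrix N s $$ (i, 0) * cofactor (eta_matrix N s) i 0)"
    using assms(1) by (intro laplace_expansion_column[OF eta_matrix_carrier]) simp
  also have "\<dots>
      = (\<Sum>i<N. of_nat (Suc i) powr (1 - s) * (2 * complex_of_real (a_coeff (Suc i) N) / of_nat (Suc i)))"
    by (simp add: entry cof del: of_nat_Suc)
  \<comment> \<open>For n = i+1, which is nonzero, n^(1-s)/n = 1/n^s.\<close>
  also have "\<dots> = (\<Sum>i<N. 2 * (complex_of_real (a_coeff (Suc i) N) / of_nat (Suc i) powr s))"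
    by (intro sum.cong) (auto simp: powr_diff simp del: of_nat_Suc)
  also have "\<dots> = 2 * eta N s"
    unfolding eta_def sum_distrib_left[symmetric]
    by (simp add: sum.atLeast1_atMost_eq)
  finally show ?thesis by simp
qed

end
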